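(* Let $q>1$ and suppose that there exists $\mathbb{Q}^*\in\mathcal{M}^s(\mathbb{P})\cap L^q(\mathbb{P})$ defined by $$\frac{d\mathbb{Q}^*}{d\mathbb{P}}:=\frac{g^*}{\mathbb{E}[g^*]}$$ for a random variable $g^*$. The following statements hold: (i) if $\mathbb{Q}^*$ is the $q$-optimal measure, then $$\mathbb{E}_{\mathbb{Q}}\big[\operatorname{sgn}(g^* )|g^*|^{q-1}\big]=1\quad\text{for every }\mathbb{Q}\in\mathcal{M}^s(\mathbb{P})\cap L^q(\mathbb{P});$$ (ii) conversely, if $\mathbb{E}_{\mathbb{Q}}[\operatorname{sgn}(g^* )|g^*|^{q-1}]=1$ for every $\mathbb{Q}\in\mathcal{M}^s(\mathbb{P})\cap L^q(\mathbb{P})$, then $\mathbb{Q}^*$ is the $q$-optimal martingale measure.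
   Context: $S=\{S_t\}_{t\ge0}$ is an $\mathbb{R}^d$-valued, locally bounded, càdlàg semimartingale defined on a filtered probability space $(\Omega,\mathcal{F},\{\mathcal{F}_t\}_{t\ge0},\mathbb{P})$; $\mathbb{E}$ is expectation under $\mathbb{P}$. $K_0$ is the linear subspace of $L^\infty(\mathbb{P})$ spanned by the simple stochastic integrals $h=\phi\,(S_{\tau_2}-S_{\tau_1})$ (dot product in $\mathbb{R}^d$), where $\tau_1\le\tau_2$ a.s. are stopping times such that the stopped process $S^{\tau_2}=\{S_{\tau_2\wedge t}\}_{t\ge0}$ is bounded, and $\phi$ is a bounded $\mathbb{R}^d$-valued $\mathcal{F}_{\tau_1}$-measurable function. The set of signed local martingale measures for $S$ is $$\mathcal{M}^s(\mathbb{P})=\{u\in L^1(\mathbb{P}):\ \mathbb{E}[uh]=0 \text{ for any } h\in K_0,\ \text{and } \mathbb{E}[u]=1\};$$ a signed measure $\mathbb{Q}$ is identified with its density $d\mathbb{Q}/d\mathbb{P}$, and $\mathbb{E}_{\mathbb{Q}}[Z]=\mathbb{E}[\frac{d\mathbb{Q}}{d\mathbb{P}}Z]$. When $\mathcal{M}^s(\mathbb{P})\cap L^q(\mathbb{P})\neq\emptyset$, the $q$-optimal (signed local martingale) measure is the unique element of $\mathcal{M}^s(\mathbb{P})$ with minimal $L^q(\mathbb{P})$-norm.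
   Formalization: In (i), g* is determined only up to scaling (for S constant, g*=2 the identity fails), so (i) is stated for g* normalised by E[|g*|^q]=E[g*], a condition its conclusion forces, together with the existence of a nonzero multiple of g* satisfying the identity; (ii) is as stated. *)

theory Defs
  imports "HOL-Probability.Probability"
begin

text \<open>
  Time is indexed by \<open>real\<close>, but processes are only ever looked at for times \<open>t \<ge> 0\<close>; a filtration
  on \<open>[0, \<infinity>)\<close> is extended to negative times by \<open>F t = F 0\<close>.  No completeness or right-continuity of
  the filtration is assumed.
\<close>

locale filtered_prob_space = prob_space M + filtration "space M" F
  for M :: "'a measure" and F :: "real \<Rightarrow> 'a measure" +
  assumes sets_F_subset: "sets (F t) \<subseteq> sets M"

text \<open>Stopping times are finite, so that \<open>S\<^sub>\<tau>\<close> makes sense.\<close>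

definition nonneg_stopping_time :: "'a measure \<Rightarrow> (real \<Rightarrow> 'a measure) \<Rightarrow> ('a \<Rightarrow> real) \<Rightarrow> bool" where
  "nonneg_stopping_time M F \<tau> \<longleftrightarrow> stopping_time F \<tau> \<and> (\<forall>w\<in>space M. 0 \<le> \<tau> w)"

definition adapted :: "(real \<Rightarrow> 'a measure) \<Rightarrow> (real \<Rightarrow> 'a \<Rightarrow> 'b::topological_space) \<Rightarrow> bool" where
  "adapted F X \<longleftrightarrow> (\<forall>t\<ge>0. X t \<in> borel_measurable (F t))"

definition cadlag :: "(real \<Rightarrow> 'b::topological_space) \<Rightarrow> bool" where
  "cadlag f \<longleftrightarrow> (\<forall>t\<ge>0. (f \<longlongrightarrow> f t) (at_right t)) \<and> (\<forall>t>0. \<exists>l. (f \<longlongrightarrow> l) (at_left t))"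

definition stopped :: "(real \<Rightarrow> 'a \<Rightarrow> 'b) \<Rightarrow> ('a \<Rightarrow> real) \<Rightarrow> real \<Rightarrow> 'a \<Rightarrow> 'b" where
  "stopped X \<tau> t w = X (min (\<tau> w) t) w"

definition bounded_process :: "'a measure \<Rightarrow> (real \<Rightarrow> 'a \<Rightarrow> 'b::real_normed_vector) \<Rightarrow> bool" where
  "bounded_process M X \<longleftrightarrow> (\<exists>C. AE w in M. \<forall>t\<ge>0. norm (X t w) \<le> C)"

definition localizing_sequence ::
    "'a measure \<Rightarrow> (real \<Rightarrow> 'a measure) \<Rightarrow> (nat \<Rightarrow> 'a \<Rightarrow> real) \<Rightarrow> bool" where
  "localizing_sequence M F \<tau> \<longleftrightarrow> (\<forall>n. nonneg_stopping_time M F (\<tau> n)) \<and>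
     (AE w in M. incseq (\<lambda>n. \<tau> n w) \<and> filterlim (\<lambda>n. \<tau> n w) at_top sequentially)"

definition locally_bounded ::
    "'a measure \<Rightarrow> (real \<Rightarrow> 'a measure) \<Rightarrow> (real \<Rightarrow> 'a \<Rightarrow> 'b::real_normed_vector) \<Rightarrow> bool" where
  "locally_bounded M F X \<longleftrightarrow>
     (\<exists>\<tau>. localizing_sequence M F \<tau> \<and> (\<forall>n. bounded_process M (stopped X (\<tau> n))))"

definition martingale ::
    "'a measure \<Rightarrow> (real \<Rightarrow> 'a measure) \<Rightarrow> (real \<Rightarrow> 'a \<Rightarrow> real) \<Rightarrow> bool" where
  "martingale M F X \<longleftrightarrow> adapted F X \<and> (\<forall>t\<ge>0. integrable M (X t)) \<and>
     (\<forall>s t. 0 \<le> s \<and> s \<le> t \<longrightarrow> (AE w in M. real_cond_exp M (F s) (X t) w = X s w))"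

definition local_martingale ::
    "'a measure \<Rightarrow> (real \<Rightarrow> 'a measure) \<Rightarrow> (real \<Rightarrow> 'a \<Rightarrow> real) \<Rightarrow> bool" where
  "local_martingale M F X \<longleftrightarrow> adapted F X \<and> (\<forall>w\<in>space M. cadlag (\<lambda>t. X t w)) \<and>
     (\<exists>\<tau>. localizing_sequence M F \<tau> \<and>
          (\<forall>n. martingale M F (\<lambda>t w. stopped X (\<tau> n) t w - X 0 w)))"

definition locally_finite_variation :: "(real \<Rightarrow> real) \<Rightarrow> bool" where
  "locally_finite_variation f \<longleftrightarrow>
     (\<forall>T\<ge>0. \<exists>B. \<forall>(n::nat) p. mono_on {..n} p \<and> p ` {..n} \<subseteq> {0..T} \<longrightarrow>
        (\<Sum>i<n. \<bar>f (p (Suc i)) - f (p i)\<bar>) \<le> B)"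

definition real_semimartingale ::
    "'a measure \<Rightarrow> (real \<Rightarrow> 'a measure) \<Rightarrow> (real \<Rightarrow> 'a \<Rightarrow> real) \<Rightarrow> bool" where
  "real_semimartingale M F X \<longleftrightarrow> adapted F X \<and> (\<forall>w\<in>space M. cadlag (\<lambda>t. X t w)) \<and>
     (\<exists>N A. local_martingale M F N \<and> adapted F A \<and>
        (\<forall>w\<in>space M. cadlag (\<lambda>t. A t w) \<and> locally_finite_variation (\<lambda>t. A t w)) \<and>
        (AE w in M. N 0 w = 0 \<and> A 0 w = 0 \<and> (\<forall>t\<ge>0. X t w = X 0 w + N t w + A t w)))"

definition cadlag_semimartingale ::
    "'a measure \<Rightarrow> (real \<Rightarrow> 'a measure) \<Rightarrow> (real \<Rightarrow> 'a \<Rightarrow> real ^ 'd) \<Rightarrow> bool" where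
  "cadlag_semimartingale M F X \<longleftrightarrow> (\<forall>i. real_semimartingale M F (\<lambda>t w. X t w $ i))"

text \<open>
  Elements of \<open>L\<^sup>p\<close> are represented by measurable functions instead of classes modulo almost sure
  equality.
\<close>

definition Lp_space :: "'a measure \<Rightarrow> real \<Rightarrow> ('a \<Rightarrow> real) set" where
  "Lp_space M p = {f \<in> borel_measurable M. integrable M (\<lambda>w. \<bar>f w\<bar> powr p)}"

definition Lp_norm :: "'a measure \<Rightarrow> real \<Rightarrow> ('a \<Rightarrow> real) \<Rightarrow> real" where
  "Lp_norm M p f = (\<integral>w. \<bar>f w\<bar> powr p \<partial>M) powr (1 / p)"

definition simple_integrals ::
    "'a measure \<Rightarrow> (real \<Rightarrow> 'a measure) \<Rightarrow> (real \<Rightarrow> 'a \<Rightarrow> real ^ 'd) \<Rightarrow> ('a \<Rightarrow> real) set" where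
  "simple_integrals M F S =
     {(\<lambda>w. \<phi> w \<bullet> (S (\<tau>\<^sub>2 w) w - S (\<tau>\<^sub>1 w) w)) | \<phi> \<tau>\<^sub>1 \<tau>\<^sub>2.
        nonneg_stopping_time M F \<tau>\<^sub>1 \<and> nonneg_stopping_time M F \<tau>\<^sub>2 \<and>
        (AE w in M. \<tau>\<^sub>1 w \<le> \<tau>\<^sub>2 w) \<and>
        bounded_process M (stopped S \<tau>\<^sub>2) \<and>
        \<phi> \<in> borel_measurable (filtration.pre_sigma (space M) F \<tau>\<^sub>1) \<and>
        bounded (\<phi> ` space M)}"

text \<open>
  The linear span, written out because the function type carries no \<open>real_vector\<close> structure.
\<close>

definition K0 ::
    "'a measure \<Rightarrow> (real \<Rightarrow> 'a measure) \<Rightarrow> (real \<Rightarrow> 'a \<Rightarrow> real ^ 'd) \<Rightarrow> ('a \<Rightarrow> real) set" where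
  "K0 M F S = {(\<lambda>w. \<Sum>i<n. c i * h i w) | (n::nat) c h. \<forall>i<n. h i \<in> simple_integrals M F S}"

text \<open>A signed measure is identified with its density with respect to \<open>M\<close>.\<close>

definition signed_martingale_measures ::
    "'a measure \<Rightarrow> (real \<Rightarrow> 'a measure) \<Rightarrow> (real \<Rightarrow> 'a \<Rightarrow> real ^ 'd) \<Rightarrow> ('a \<Rightarrow> real) set" where
  "signed_martingale_measures M F S =
     {u. integrable M u \<and> (\<forall>h\<in>K0 M F S. (\<integral>w. u w * h w \<partial>M) = 0) \<and> (\<integral>w. u w \<partial>M) = 1}"

definition signed_expectation :: "'a measure \<Rightarrow> ('a \<Rightarrow> real) \<Rightarrow> ('a \<Rightarrow> real) \<Rightarrow> real" where
  "signed_expectation M u Z = (\<integral>w. u w * Z w \<partial>M)"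

text \<open>The minimizer of the \<open>L\<^sup>q\<close> norm, including its uniqueness up to almost sure equality.\<close>

definition q_optimal ::
    "'a measure \<Rightarrow> (real \<Rightarrow> 'a measure) \<Rightarrow> (real \<Rightarrow> 'a \<Rightarrow> real ^ 'd) \<Rightarrow> real \<Rightarrow> ('a \<Rightarrow> real) \<Rightarrow> bool"
  where
  "q_optimal M F S q u \<longleftrightarrow>
     u \<in> signed_martingale_measures M F S \<inter> Lp_space M q \<and>
     (\<forall>v \<in> signed_martingale_measures M F S \<inter> Lp_space M q. Lp_norm M q u \<le> Lp_norm M q v) \<and>
     (\<forall>v \<in> signed_martingale_measures M F S \<inter> Lp_space M q.
        Lp_norm M q v = Lp_norm M q u \<longrightarrow> (AE w in M. v w = u w))"

end

theory Submission
  imports Defs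
begin

text \<open>
  With \<open>\<psi> x = sgn x * \<bar>x\<bar> powr (q - 1)\<close>, the derivative of \<open>\<bar>x\<bar> powr q\<close> is \<open>q * \<psi> x\<close>. The admissible
  densities form an affine set, so by strict convexity \<open>u\<close> is the unique minimizer of the norm on it
  iff \<open>\<psi> \<circ> u\<close> annihilates all differences \<open>v - u\<close>, that is, iff the expectation of \<open>\<psi> \<circ> u\<close> is the same
  under all admissible \<open>v\<close>. As \<open>\<psi>\<close> is multiplicative, normalising \<open>g\<close> only changes that constant.
\<close>

section \<open>The signed power and the strict tangent inequality for
  \<open>\<bar>x\<bar> powr q\<close>\<close>

definition signed_powr :: "real \<Rightarrow> real \<Rightarrow> real" where
  "signed_powr p x = sgn x * \<bar>x\<bar> powr p"

lemma signed_powr_mult: "signed_powr p (x * y) = signed_powr p x * signed_powr p y"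
  by (simp add: signed_powr_def sgn_mult abs_mult powr_mult)

lemma abs_signed_powr: "\<bar>signed_powr p x\<bar> = \<bar>x\<bar> powr p"
  by (auto simp: signed_powr_def abs_mult sgn_if)

lemma signed_powr_of_pos: "x > 0 \<Longrightarrow> signed_powr p x = x powr p"
  by (simp add: signed_powr_def)

lemma signed_powr_mult_self: "signed_powr (p - 1) x * x = \<bar>x\<bar> powr p"
proof (cases "x = 0")
  case False
  then have "\<bar>x\<bar> powr p = \<bar>x\<bar> powr (p - 1) * \<bar>x\<bar>"
    by (simp add: powr_diff)
  then show ?thesis by (simp add: signed_powr_def sgn_if)
qed (simp add: signed_powr_def)

lemma isCont_signed_powr:
  assumes "p > 0"
  shows "isCont (signed_powr p) x"
proof (cases "x = 0")
  case True
  \<comment> \<open>\<open>sgn\<close> jumps at 0, so limits cannot be taken factor by factor; it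
    suffices that the absolute value tends to 0.\<close>
  have "((\<lambda>y. \<bar>y\<bar> powr p) \<longlongrightarrow> \<bar>0\<bar> powr p) (at (0::real))"
    using assms by (intro tendsto_powr' tendsto_intros) auto
  then have "((\<lambda>y. \<bar>signed_powr p y\<bar>) \<longlongrightarrow> 0) (at 0)"
    by (simp add: abs_signed_powr)
  then show ?thesis
    unfolding tendsto_rabs_zero_iff using True by (simp add: isCont_def signed_powr_def[of p 0])
next
  case False
  have "((\<lambda>y. sgn y * \<bar>y\<bar> powr p) \<longlongrightarrow> sgn x * \<bar>x\<bar> powr p) (at x)"
    using False by (intro tendsto_mult tendsto_powr tendsto_sgn tendsto_intros) auto
  then show ?thesis
    by (simp add: isCont_def signed_powr_def[abs_def])
qed

lemma borel_measurable_signed_powr [measurable]: "signed_powr p \<in> borel_measurable borel"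
  unfolding signed_powr_def[abs_def] by measurable

text \<open>Strict Bernoulli inequality. The derivative of the gap \<open>f\<close> has the sign of
  \<open>x - 1\<close>, so the mean value theorem on either side of 1 puts \<open>f r\<close>
  strictly above \<open>f 1 = 0\<close>.\<close>

lemma powr_above_tangent_at_1:
  fixes q r :: real
  assumes "q > 1" "r > 0" "r \<noteq> 1"
  shows "1 + q * (r - 1) < r powr q"
proof -
  define f where "f = (\<lambda>x::real. x powr q - 1 - q * (x - 1))"
  have D: "(f has_real_derivative q * (x powr (q - 1) - 1)) (at x)" if "x > 0" for x
    unfolding f_def using that by (auto intro!: derivative_eq_intros simp: algebra_simps)
  have "f 1 < f r"
  proof (cases "r > 1")
    case True
    then obtain z where "1 < z" "f r - f 1 = (r - 1) * (q * (z powr (q - 1) - 1))"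
      using MVT2[of 1 r f "\<lambda>x. q * (x powr (q - 1) - 1)"] D by auto
    then show ?thesis using True assms
      by (smt (verit) gr_one_powr mult_pos_pos)
  next
    case False
    then have "r < 1" using assms by simp
    then obtain z where z: "r < z" "z < 1" "f 1 - f r = (1 - r) * (q * (z powr (q - 1) - 1))"
      using MVT2[of r 1 f "\<lambda>x. q * (x powr (q - 1) - 1)"] D assms by auto
    have "z powr (q - 1) < 1 powr (q - 1)"
      using z assms by (intro powr_less_mono2) auto
    then have "(1 - r) * (q * (z powr (q - 1) - 1)) < 0"
      using \<open>r < 1\<close> assms by (intro mult_pos_neg) auto
    then show ?thesis using z by simp
  qed
  then show ?thesis by (simp add: f_def)
qed

text \<open>Both sides are homogeneous of degree \<open>q\<close>, so for
  \<open>u \<noteq> 0\<close> division by \<open>\<bar>u\<bar> powr q\<close> moves the base point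
  to 1, with \<open>r = v / u\<close>. For \<open>r > 0\<close> this is Bernoulli; for
  \<open>r \<le> 0\<close> the tangent is at most \<open>1 - q < 0\<close>. The strictness later
  gives uniqueness of the minimizer.\<close>

lemma abs_powr_strict_above_tangent:
  fixes q u v :: real
  assumes "q > 1" "u \<noteq> v"
  shows "\<bar>u\<bar> powr q + q * signed_powr (q - 1) u * (v - u) < \<bar>v\<bar> powr q"
proof (cases "u = 0")
  case True
  then show ?thesis using assms by (simp add: signed_powr_def)
next
  case False
  define r where "r = v / u"
  have v: "v = r * u" using False by (simp add: r_def)
  have "1 + q * (r - 1) < \<bar>r\<bar> powr q"
  proof (cases "r > 0")
    case True
    then show ?thesis using powr_above_tangent_at_1[of q r] assms v by auto
  next
    case False
    then have "q * (r - 1) \<le> q * (-1)"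
      using assms by (intro mult_left_mono) auto
    then show ?thesis using assms powr_ge_zero[of "\<bar>r\<bar>" q] by linarith
  qed
  then have "\<bar>u\<bar> powr q * (1 + q * (r - 1)) < \<bar>u\<bar> powr q * \<bar>r\<bar> powr q"
    using False by simp
  moreover have "\<bar>u\<bar> powr q + q * signed_powr (q - 1) u * (v - u)
      = \<bar>u\<bar> powr q + q * (signed_powr (q - 1) u * u) * (r - 1)"
    by (simp add: v algebra_simps)
  ultimately show ?thesis
    unfolding signed_powr_mult_self by (simp add: v abs_mult powr_mult algebra_simps)
qed

lemma abs_powr_above_tangent:
  fixes q u v :: real
  assumes "q > 1"
  shows "\<bar>u\<bar> powr q + q * signed_powr (q - 1) u * (v - u) \<le> \<bar>v\<bar> powr q"
  using abs_powr_strict_above_tangent[of q u v] assms by (cases "u = v") auto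

section \<open>Integrability of powers and products of functions in \<open>Lp_space\<close>\<close>

text \<open>A pointwise substitute for Hoelder's inequality: with
  \<open>z = \<bar>u\<bar> + \<bar>v\<bar>\<close> it gives one majorant \<open>z powr q\<close>,
  used both for integrability of the pairing and for dominated convergence.\<close>

lemma powr_minus_one_mult_le:
  fixes x y q :: real
  assumes "q \<ge> 1" "0 \<le> x" "x \<le> z" "0 \<le> y" "y \<le> z"
  shows "x powr (q - 1) * y \<le> z powr q"
proof -
  have "x powr (q - 1) * y \<le> z powr (q - 1) * z"
    using assms by (intro mult_mono powr_mono2) auto
  also have "\<dots> = z powr q"
    using assms by (cases "z = 0") (auto simp: powr_diff)
  finally show ?thesis .
qed

text \<open>The sum is at most twice the maximum, whence the factor \<open>2 powr q\<close>; the
  power of the maximum is one of the two summands.\<close>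

lemma powr_add_le:
  fixes x y q :: real
  assumes "q \<ge> 0" "0 \<le> x" "0 \<le> y"
  shows "(x + y) powr q \<le> 2 powr q * (x powr q + y powr q)"
proof -
  have "(x + y) powr q \<le> (2 * max x y) powr q"
    using assms by (intro powr_mono2) auto
  also have "\<dots> = 2 powr q * max x y powr q"
    using assms by (simp add: powr_mult)
  also have "\<dots> \<le> 2 powr q * (x powr q + y powr q)"
    by (intro mult_left_mono) (auto simp: max_def)
  finally show ?thesis .
qed

lemma Lp_space_sum_abs_powr_integrable:
  assumes "q \<ge> 0" "u \<in> Lp_space M q" "v \<in> Lp_space M q"
  shows "integrable M (\<lambda>w. (\<bar>u w\<bar> + \<bar>v w\<bar>) powr q)"
proof (rule Bochner_Integration.integrable_bound)
  show "integrable M (\<lambda>w. 2 powr q * (\<bar>u w\<bar> powr q + \<bar>v w\<bar> powr q))"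
    using assms by (auto simp: Lp_space_def)
  show "(\<lambda>w. (\<bar>u w\<bar> + \<bar>v w\<bar>) powr q) \<in> borel_measurable M"
    using assms by (auto simp: Lp_space_def)
  show "AE w in M. norm ((\<bar>u w\<bar> + \<bar>v w\<bar>) powr q) \<le> norm (2 powr q * (\<bar>u w\<bar> powr q + \<bar>v w\<bar> powr q))"
    using assms(1) powr_add_le[of q] by auto
qed

lemma Lp_space_add:
  assumes "q \<ge> 0" "u \<in> Lp_space M q" "v \<in> Lp_space M q"
  shows "(\<lambda>w. u w + v w) \<in> Lp_space M q"
proof -
  have [measurable]: "u \<in> borel_measurable M" "v \<in> borel_measurable M"
    using assms by (auto simp: Lp_space_def)
  have "integrable M (\<lambda>w. \<bar>u w + v w\<bar> powr q)"
    using assms(1)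
    by (intro Bochner_Integration.integrable_bound[OF Lp_space_sum_abs_powr_integrable[OF assms]])
       (auto intro!: AE_I2 powr_mono2)
  then show ?thesis by (simp add: Lp_space_def)
qed

lemma Lp_space_cmult:
  assumes "u \<in> Lp_space M q"
  shows "(\<lambda>w. c * u w) \<in> Lp_space M q"
  using assms by (auto simp: Lp_space_def abs_mult powr_mult)

lemma Lp_space_diff:
  assumes "q \<ge> 0" "u \<in> Lp_space M q" "v \<in> Lp_space M q"
  shows "(\<lambda>w. u w - v w) \<in> Lp_space M q"
  using Lp_space_add[OF assms(1,2) Lp_space_cmult[OF assms(3), of "-1"]] by simp

lemma integrable_signed_powr_mult:
  assumes "q > 1" "u \<in> Lp_space M q" "v \<in> Lp_space M q"
  shows "integrable M (\<lambda>w. signed_powr (q - 1) (u w) * v w)"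
proof (rule Bochner_Integration.integrable_bound)
  show "integrable M (\<lambda>w. (\<bar>u w\<bar> + \<bar>v w\<bar>) powr q)"
    using assms by (intro Lp_space_sum_abs_powr_integrable) auto
  have [measurable]: "u \<in> borel_measurable M" "v \<in> borel_measurable M"
    using assms by (auto simp: Lp_space_def)
  show "(\<lambda>w. signed_powr (q - 1) (u w) * v w) \<in> borel_measurable M"
    by measurable
  show "AE w in M. norm (signed_powr (q - 1) (u w) * v w) \<le> norm ((\<bar>u w\<bar> + \<bar>v w\<bar>) powr q)"
    using assms(1) by (auto simp: abs_mult abs_signed_powr intro!: powr_minus_one_mult_le)
qed

section \<open>Minimizing the norm: integrated tangent bound and first-order condition\<close>

lemma Lp_norm_le_iff:
  assumes "q > 0"
  shows "Lp_norm M q u \<le> Lp_norm M q v \<longleftrightarrow> (\<integral>w. \<bar>u w\<bar> powr q \<partial>M) \<le> (\<integral>w. \<bar>v w\<bar> powr q \<partial>M)"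
proof
  assume "(\<integral>w. \<bar>u w\<bar> powr q \<partial>M) \<le> (\<integral>w. \<bar>v w\<bar> powr q \<partial>M)"
  then show "Lp_norm M q u \<le> Lp_norm M q v"
    using assms unfolding Lp_norm_def by (intro powr_mono2) auto
next
  assume le: "Lp_norm M q u \<le> Lp_norm M q v"
  show "(\<integral>w. \<bar>u w\<bar> powr q \<partial>M) \<le> (\<integral>w. \<bar>v w\<bar> powr q \<partial>M)"
  proof (rule ccontr)
    assume "\<not> ?thesis"
    then have "Lp_norm M q v < Lp_norm M q u"
      using assms unfolding Lp_norm_def by (intro powr_less_mono2) auto
    then show False using le by simp
  qed
qed

text \<open>Integrate the tangent inequality: the remainder \<open>r\<close> is nonnegative, and if
  its integral vanishes then \<open>r = 0\<close> almost everywhere, which strictness allows only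
  where \<open>v = u\<close>. The one-sided hypothesis covers both uses: a zero derivative in the
  optimality criterion and a positive one in the contradiction behind the first-order
  condition.\<close>

lemma integral_abs_powr_tangent:
  assumes "q > 1" and u: "u \<in> Lp_space M q" and v: "v \<in> Lp_space M q"
    and zero: "(\<integral>w. signed_powr (q - 1) (u w) * (v w - u w) \<partial>M) \<ge> 0"
  shows "(\<integral>w. \<bar>u w\<bar> powr q \<partial>M) \<le> (\<integral>w. \<bar>v w\<bar> powr q \<partial>M)"
    and "(\<integral>w. \<bar>v w\<bar> powr q \<partial>M) \<le> (\<integral>w. \<bar>u w\<bar> powr q \<partial>M) \<Longrightarrow> AE w in M. v w = u w"
proof -
  define r where
    "r w = \<bar>v w\<bar> powr q - \<bar>u w\<bar> powr q - q * (signed_powr (q - 1) (u w) * (v w - u w))" for w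
  have I: "integrable M (\<lambda>w. \<bar>u w\<bar> powr q)" "integrable M (\<lambda>w. \<bar>v w\<bar> powr q)"
    "integrable M (\<lambda>w. signed_powr (q - 1) (u w) * (v w - u w))"
    using u v integrable_signed_powr_mult[OF \<open>q > 1\<close> u Lp_space_diff[OF _ v u]] \<open>q > 1\<close>
    by (auto simp: Lp_space_def)
  have r: "integrable M r" "(\<integral>w. r w \<partial>M) = (\<integral>w. \<bar>v w\<bar> powr q \<partial>M) - (\<integral>w. \<bar>u w\<bar> powr q \<partial>M)
      - q * (\<integral>w. signed_powr (q - 1) (u w) * (v w - u w) \<partial>M)"
    unfolding r_def using I by auto
  have r0: "r w \<ge> 0" for w
    using abs_powr_above_tangent[OF \<open>q > 1\<close>, of "u w" "v w"] by (simp add: r_def mult.assoc)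
  have le: "(\<integral>w. r w \<partial>M) \<le> (\<integral>w. \<bar>v w\<bar> powr q \<partial>M) - (\<integral>w. \<bar>u w\<bar> powr q \<partial>M)"
    using r zero \<open>q > 1\<close> by simp
  moreover have ge: "0 \<le> (\<integral>w. r w \<partial>M)" using r0 by simp
  ultimately show "(\<integral>w. \<bar>u w\<bar> powr q \<partial>M) \<le> (\<integral>w. \<bar>v w\<bar> powr q \<partial>M)"
    by linarith
  assume "(\<integral>w. \<bar>v w\<bar> powr q \<partial>M) \<le> (\<integral>w. \<bar>u w\<bar> powr q \<partial>M)"
  then have "(\<integral>w. r w \<partial>M) = 0" using le ge by linarith
  then have "AE w in M. r w = 0"
    using integral_nonneg_eq_0_iff_AE[OF r(1)] r0 by simp
  then show "AE w in M. v w = u w"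
  proof eventually_elim
    case (elim w)
    then show ?case
      using abs_powr_strict_above_tangent[OF \<open>q > 1\<close>, of "u w" "v w"]
      by (cases "v w = u w") (auto simp: r_def mult.assoc)
  qed
qed

text \<open>Up to the factor \<open>q\<close>, \<open>J t\<close> is the formal derivative of the
  q-th power integral along \<open>u + t * d\<close>. Nothing is differentiated under the integral:
  convexity and minimality at \<open>t = 0\<close> give \<open>0 \<le> t * J t\<close>, and
  continuity of \<open>J\<close> at 0 then forces \<open>J 0 = 0\<close>.\<close>

lemma Lp_minimizer_first_order:
  assumes "q > 1" and u: "u \<in> Lp_space M q" and d: "d \<in> Lp_space M q"
    and min: "\<And>t. (\<integral>w. \<bar>u w\<bar> powr q \<partial>M) \<le> (\<integral>w. \<bar>u w + t * d w\<bar> powr q \<partial>M)"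
  shows "(\<integral>w. signed_powr (q - 1) (u w) * d w \<partial>M) = 0"
proof -
  define J where "J t = (\<integral>w. signed_powr (q - 1) (u w + t * d w) * d w \<partial>M)" for t
  have [measurable]: "u \<in> borel_measurable M" "d \<in> borel_measurable M"
    using u d by (auto simp: Lp_space_def)
  have J: "0 \<le> t * J t" for t
  proof (rule ccontr)
    assume *: "\<not> 0 \<le> t * J t"
    have ut: "(\<lambda>w. u w + t * d w) \<in> Lp_space M q"
      using u d \<open>q > 1\<close> by (intro Lp_space_add Lp_space_cmult) auto
    have "(\<integral>w. signed_powr (q - 1) (u w + t * d w) * (u w - (u w + t * d w)) \<partial>M)
        = (\<integral>w. (- t) * (signed_powr (q - 1) (u w + t * d w) * d w) \<partial>M)"
      by (intro Bochner_Integration.integral_cong) (auto simp: algebra_simps)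
    also have "\<dots> = - (t * J t)" by (simp add: J_def)
    finally have eq: "(\<integral>w. signed_powr (q - 1) (u w + t * d w) * (u w - (u w + t * d w)) \<partial>M)
        = - (t * J t)" .
    \<comment> \<open>The tangent is taken at \<open>u + t * d\<close> and evaluated at
      \<open>u\<close>. If \<open>t * J t < 0\<close>, it rises towards \<open>u\<close>, so
      minimality of \<open>u\<close> forces the two functions to agree almost everywhere; the
      integral in \<open>eq\<close> is then 0, a contradiction.\<close>
    then have "AE w in M. u w = u w + t * d w"
      using * min[of t] by (intro integral_abs_powr_tangent(2)[OF \<open>q > 1\<close> ut u]) auto
    then have "(\<integral>w. signed_powr (q - 1) (u w + t * d w) * (u w - (u w + t * d w)) \<partial>M) = 0"
      by (intro integral_eq_zero_AE) auto
    then have "t * J t = 0" using eq by linarith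
    then show False using * by auto
  qed
  \<comment> \<open>The restriction \<open>\<bar>t n\<bar> \<le> 1\<close> gives
    \<open>\<bar>u + t n * d\<bar> \<le> \<bar>u\<bar> + \<bar>d\<bar>\<close>, hence a majorant
    independent of \<open>n\<close>.\<close>
  have lim: "(\<lambda>n. J (t n)) \<longlonglongrightarrow> J 0" if t: "t \<longlonglongrightarrow> 0" "\<And>n. \<bar>t n\<bar> \<le> 1" for t :: "nat \<Rightarrow> real"
    unfolding J_def
  proof (rule integral_dominated_convergence)
    show "integrable M (\<lambda>w. (\<bar>u w\<bar> + \<bar>d w\<bar>) powr q)"
      using u d \<open>q > 1\<close> by (intro Lp_space_sum_abs_powr_integrable) auto
    show "AE w in M. (\<lambda>n. signed_powr (q - 1) (u w + t n * d w) * d w)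
        \<longlonglongrightarrow> signed_powr (q - 1) (u w + 0 * d w) * d w"
      using t \<open>q > 1\<close>
      by (intro AE_I2 tendsto_mult isCont_tendsto_compose[OF isCont_signed_powr] tendsto_intros) auto
    show "AE w in M. norm (signed_powr (q - 1) (u w + t n * d w) * d w)
        \<le> (\<bar>u w\<bar> + \<bar>d w\<bar>) powr q" for n
    proof (rule AE_I2)
      fix w
      have "\<bar>t n * d w\<bar> \<le> \<bar>d w\<bar>"
        using mult_right_mono[OF t(2)[of n], of "\<bar>d w\<bar>"] by (simp add: abs_mult)
      then have "\<bar>u w + t n * d w\<bar> \<le> \<bar>u w\<bar> + \<bar>d w\<bar>"
        by linarith
      then show "norm (signed_powr (q - 1) (u w + t n * d w) * d w) \<le> (\<bar>u w\<bar> + \<bar>d w\<bar>) powr q"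
        using \<open>q > 1\<close> by (auto simp: abs_mult abs_signed_powr intro!: powr_minus_one_mult_le)
    qed
  qed measurable
  \<comment> \<open>Approaching 0 from the right, where \<open>J\<close> is nonnegative, and below
    from the left, where it is nonpositive, squeezes \<open>J 0\<close>.\<close>
  have pos: "(\<lambda>n. J (inverse (real (Suc n)))) \<longlonglongrightarrow> J 0"
    by (rule lim[OF LIMSEQ_inverse_real_of_nat]) (auto simp: field_simps)
  have "J (inverse (real (Suc n))) \<ge> 0" for n
    using J[of "inverse (real (Suc n))"] by (simp add: zero_le_mult_iff)
  then have "J 0 \<ge> 0"
    by (intro LIMSEQ_le_const[OF pos]) auto
  moreover have neg: "(\<lambda>n. J (- inverse (real (Suc n)))) \<longlonglongrightarrow> J 0"
    using tendsto_minus[OF LIMSEQ_inverse_real_of_nat] by (intro lim) (auto simp: field_simps)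
  have "J (- inverse (real (Suc n))) \<le> 0" for n
    using J[of "- inverse (real (Suc n))"] by (simp add: mult_le_0_iff)
  then have "J 0 \<le> 0"
    by (intro LIMSEQ_le_const2[OF neg]) auto
  ultimately show ?thesis by (simp add: J_def)
qed

section \<open>Measurability and boundedness of simple stochastic integrals\<close>

text \<open>Approximate \<open>\<tau>\<close> from the right by random times with countably many
  values, where measurability can be checked value by value, and pass to the limit by
  right-continuity of the paths.\<close>

lemma (in filtered_prob_space) measurable_process_at_stopping_time:
  fixes X :: "real \<Rightarrow> 'a \<Rightarrow> 'b::metric_space"
  assumes X: "adapted F X" "\<And>w. w \<in> space M \<Longrightarrow> cadlag (\<lambda>t. X t w)"
    and \<tau>: "nonneg_stopping_time M F \<tau>"
  shows "(\<lambda>w. X (\<tau> w) w) \<in> borel_measurable M"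
proof -
  \<comment> \<open>\<open>\<tau>'\<close> is the first point of the grid of mesh
    \<open>1 / Suc n\<close> strictly after \<open>\<tau>\<close>. The extra \<open>Suc\<close> in
    the numerator keeps it off \<open>\<tau>\<close> itself, so that convergence takes place in
    \<open>at_right\<close>.\<close>
  define k where "k n w = nat \<lfloor>real (Suc n) * \<tau> w\<rfloor>" for n w
  define \<tau>' where "\<tau>' n w = real (Suc (k n w)) / real (Suc n)" for n w
  have [measurable]: "\<tau> \<in> borel_measurable M"
    using \<tau> measurable_stopping_time[of F \<tau> M] sets_F_subset space_F
    by (simp add: nonneg_stopping_time_def)
  have X_meas: "X t \<in> borel_measurable M" if "t \<ge> 0" for t
    using X(1) that measurable_mono[of borel borel "F t" M] sets_F_subset[of t] space_F[of t]
    by (auto simp: adapted_def)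
  show ?thesis
  proof (rule borel_measurable_LIMSEQ_metric)
    fix n
    have [measurable]: "k n \<in> measurable M (count_space UNIV)"
      unfolding k_def by measurable
    show "(\<lambda>w. X (\<tau>' n w) w) \<in> borel_measurable M"
      unfolding \<tau>'_def
      by (rule measurable_compose_countable[where f = "\<lambda>i w. X (real (Suc i) / real (Suc n)) w"])
        (auto intro!: X_meas)
  next
    fix w assume w: "w \<in> space M"
    then have "0 \<le> \<tau> w" using \<tau> by (simp add: nonneg_stopping_time_def)
    have bds: "\<tau> w < \<tau>' n w" "\<tau>' n w \<le> \<tau> w + inverse (real (Suc n))" for n
    proof -
      have "real (k n w) = of_int \<lfloor>real (Suc n) * \<tau> w\<rfloor>"
        using \<open>0 \<le> \<tau> w\<close> by (simp add: k_def)
      then have "real (k n w) \<le> \<tau> w * real (Suc n)" "\<tau> w * real (Suc n) < real (Suc (k n w))"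
        by (simp_all only: mult.commute of_nat_Suc) linarith+
      then have "real (k n w) / real (Suc n) \<le> \<tau> w" "\<tau> w < real (Suc (k n w)) / real (Suc n)"
        by (simp_all only: pos_divide_le_eq pos_less_divide_eq of_nat_0_less_iff zero_less_Suc)
      moreover have "\<tau>' n w = real (k n w) / real (Suc n) + inverse (real (Suc n))"
        by (simp add: \<tau>'_def field_simps)
      ultimately show "\<tau> w < \<tau>' n w" "\<tau>' n w \<le> \<tau> w + inverse (real (Suc n))"
        by (simp_all add: \<tau>'_def)
    qed
    have "(\<lambda>n. \<tau>' n w) \<longlonglongrightarrow> \<tau> w"
    proof (rule tendsto_sandwich[where f = "\<lambda>_. \<tau> w" and h = "\<lambda>n. \<tau> w + inverse (real (Suc n))"])
      show "(\<lambda>n. \<tau> w + inverse (real (Suc n))) \<longlonglongrightarrow> \<tau> w"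
        using tendsto_add[OF tendsto_const LIMSEQ_inverse_real_of_nat] by simp
      show "\<forall>\<^sub>F n in sequentially. \<tau> w \<le> \<tau>' n w"
        using bds(1) by (simp add: less_imp_le)
      show "\<forall>\<^sub>F n in sequentially. \<tau>' n w \<le> \<tau> w + inverse (real (Suc n))"
        using bds(2) by simp
    qed simp
    then have "filterlim (\<lambda>n. \<tau>' n w) (at_right (\<tau> w)) sequentially"
      using less_imp_neq[OF bds(1)] bds(1)
      by (auto simp: filterlim_at eq_commute[of "\<tau>' _ w"] intro!: always_eventually)
    moreover have "((\<lambda>t. X t w) \<longlongrightarrow> X (\<tau> w) w) (at_right (\<tau> w))"
      using X(2)[OF w] \<open>0 \<le> \<tau> w\<close> by (simp add: cadlag_def)
    ultimately show "(\<lambda>n. X (\<tau>' n w) w) \<longlonglongrightarrow> X (\<tau> w) w"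
      by (rule filterlim_compose[rotated])
  qed
qed

text \<open>As \<open>\<tau>\<close> is real-valued, \<open>A\<close> is exhausted by its parts on
  which \<open>\<tau> w \<le> real n\<close>, and each of these lies in
  \<open>F (real n)\<close>.\<close>

lemma (in filtered_prob_space) sets_pre_sigma_subset:
  fixes \<tau> :: "'a \<Rightarrow> real"
  assumes "stopping_time F \<tau>"
  shows "sets (pre_sigma \<tau>) \<subseteq> sets M"
proof
  fix A assume A: "A \<in> sets (pre_sigma \<tau>)"
  have "{w\<in>A. \<tau> w \<le> real n} \<in> sets M" for n
    using sets_pre_sigmaD[OF assms A] sets_F_subset by blast
  then have "(\<Union>n. {w\<in>A. \<tau> w \<le> real n}) \<in> sets M"
    by auto
  also have "(\<Union>n. {w\<in>A. \<tau> w \<le> real n}) = A"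
    by (auto intro: real_arch_simple)
  finally show "A \<in> sets M" .
qed

text \<open>These two facts make the product of a simple integral with any integrable density
  integrable.\<close>

lemma (in filtered_prob_space) simple_integral_essentially_bounded:
  fixes S :: "real \<Rightarrow> 'a \<Rightarrow> real ^ 'd"
  assumes S: "cadlag_semimartingale M F S" and h: "h \<in> simple_integrals M F S"
  shows "h \<in> borel_measurable M" "\<exists>C. AE w in M. \<bar>h w\<bar> \<le> C"
proof -
  obtain \<phi> \<tau>1 \<tau>2 where h_eq: "h = (\<lambda>w. \<phi> w \<bullet> (S (\<tau>2 w) w - S (\<tau>1 w) w))"
    and \<tau>: "nonneg_stopping_time M F \<tau>1" "nonneg_stopping_time M F \<tau>2" "AE w in M. \<tau>1 w \<le> \<tau>2 w"
    and bdd: "bounded_process M (stopped S \<tau>2)"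
    and \<phi>: "\<phi> \<in> borel_measurable (pre_sigma \<tau>1)" "bounded (\<phi> ` space M)"
    using h unfolding simple_integrals_def by blast
  have S_at [measurable]: "(\<lambda>w. S (\<tau> w) w) \<in> borel_measurable M"
    if "nonneg_stopping_time M F \<tau>" for \<tau>
  proof (rule borel_measurable_euclidean_space[THEN iffD2], intro ballI)
    fix b :: "real ^ 'd" assume "b \<in> Basis"
    then obtain i where b: "b = axis i 1" by (auto simp: Basis_vec_def)
    have "(\<lambda>w. S (\<tau> w) w $ i) \<in> borel_measurable M"
      using S that
      by (intro measurable_process_at_stopping_time)
        (auto simp: cadlag_semimartingale_def real_semimartingale_def)
    then show "(\<lambda>w. S (\<tau> w) w \<bullet> b) \<in> borel_measurable M"
      by (simp add: b inner_axis)
  qed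
  have [measurable]: "\<phi> \<in> borel_measurable M"
    using \<phi>(1) \<tau>(1) measurable_mono[of borel borel "pre_sigma \<tau>1" M] sets_pre_sigma_subset[of \<tau>1]
    by (auto simp: nonneg_stopping_time_def space_pre_sigma)
  show "h \<in> borel_measurable M"
    unfolding h_eq using S_at[OF \<tau>(1)] S_at[OF \<tau>(2)] by measurable
  obtain C where C: "AE w in M. \<forall>t\<ge>0. norm (S (min (\<tau>2 w) t) w) \<le> C"
    using bdd by (auto simp: bounded_process_def stopped_def)
  obtain B where B: "\<And>w. w \<in> space M \<Longrightarrow> norm (\<phi> w) \<le> B"
    using \<phi>(2) by (auto simp: bounded_iff)
  have "AE w in M. \<bar>h w\<bar> \<le> B * (C + C)"
    using C \<tau>(3) AE_space
  proof eventually_elim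
    case (elim w)
    \<comment> \<open>Evaluate the stopped process at the times \<open>\<tau>2 w\<close> and
      \<open>\<tau>1 w\<close>; since \<open>\<tau>1 w \<le> \<tau>2 w\<close>, stopping changes
      neither value, and one bound serves both.\<close>
    have "norm (S (\<tau>2 w) w) \<le> C" "norm (S (\<tau>1 w) w) \<le> C"
      using elim \<tau>(1,2) elim(1)[rule_format, of "\<tau>2 w"] elim(1)[rule_format, of "\<tau>1 w"]
      by (auto simp: nonneg_stopping_time_def min_def split: if_splits)
    then have "norm (S (\<tau>2 w) w - S (\<tau>1 w) w) \<le> C + C"
      using norm_triangle_ineq4[of "S (\<tau>2 w) w" "S (\<tau>1 w) w"] by linarith
    then have "norm (\<phi> w) * norm (S (\<tau>2 w) w - S (\<tau>1 w) w) \<le> B * (C + C)"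
      using B[OF elim(3)] order_trans[OF norm_ge_zero B[OF elim(3)]] by (intro mult_mono) auto
    then show ?case
      unfolding h_eq using Cauchy_Schwarz_ineq2 order_trans by blast
  qed
  then show "\<exists>C. AE w in M. \<bar>h w\<bar> \<le> C" ..
qed

text \<open>The integral of a non-integrable function is 0 by default, so a vanishing integral alone
  does not allow splitting sums. Integrability holds as the product of an integrable and an
  essentially bounded function.\<close>

lemma (in filtered_prob_space) integrable_mult_K0:
  fixes S :: "real \<Rightarrow> 'a \<Rightarrow> real ^ 'd"
  assumes S: "cadlag_semimartingale M F S" and u: "integrable M u" and h: "h \<in> K0 M F S"
  shows "integrable M (\<lambda>w. u w * h w)"
proof -
  have simple: "integrable M (\<lambda>w. u w * k w)" if k: "k \<in> simple_integrals M F S" for k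
  proof -
    obtain C where C: "AE w in M. \<bar>k w\<bar> \<le> C"
      using simple_integral_essentially_bounded(2)[OF S k] by auto
    show ?thesis
    proof (rule Bochner_Integration.integrable_bound)
      show "integrable M (\<lambda>w. u w * C)" using u by simp
      show "(\<lambda>w. u w * k w) \<in> borel_measurable M"
        using u simple_integral_essentially_bounded(1)[OF S k] by simp
      show "AE w in M. norm (u w * k w) \<le> norm (u w * C)"
        using C by eventually_elim (auto simp: abs_mult intro!: mult_left_mono)
    qed
  qed
  obtain n :: nat and c k where h_eq: "h = (\<lambda>w. \<Sum>i<n. c i * k i w)"
    and k: "\<And>i. i < n \<Longrightarrow> k i \<in> simple_integrals M F S"
    using h unfolding K0_def by blast
  have "integrable M (\<lambda>w. \<Sum>i<n. c i * (u w * k i w))"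
    using simple[OF k] by (intro Bochner_Integration.integrable_sum integrable_mult_right) auto
  then show ?thesis
    by (simp add: h_eq sum_distrib_left mult.left_commute)
qed

section \<open>The affine set of densities and the variational criterion for optimality\<close>

text \<open>Densities may be negative, so \<open>t\<close> ranges over all reals and not only over
  the unit interval. Moving both ways along the line makes the first-order condition an
  equality.\<close>

lemma (in filtered_prob_space) signed_martingale_measures_affine:
  fixes S :: "real \<Rightarrow> 'a \<Rightarrow> real ^ 'd"
  assumes S: "cadlag_semimartingale M F S"
    and u: "u \<in> signed_martingale_measures M F S" and v: "v \<in> signed_martingale_measures M F S"
  shows "(\<lambda>w. u w + t * (v w - u w)) \<in> signed_martingale_measures M F S"
proof -
  have I: "integrable M u" "integrable M v" "(\<integral>w. u w \<partial>M) = 1" "(\<integral>w. v w \<partial>M) = 1"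
    using u v by (auto simp: signed_martingale_measures_def)
  have "(\<integral>w. (u w + t * (v w - u w)) * h w \<partial>M) = 0" if h: "h \<in> K0 M F S" for h
  proof -
    have "(\<integral>w. (u w + t * (v w - u w)) * h w \<partial>M)
        = (\<integral>w. u w * h w + t * (v w * h w - u w * h w) \<partial>M)"
      by (simp add: algebra_simps)
    also have "\<dots> = 0"
      using integrable_mult_K0[OF S I(1) h] integrable_mult_K0[OF S I(2) h] u v h
      by (simp add: signed_martingale_measures_def)
    finally show ?thesis .
  qed
  then show ?thesis using I by (simp add: signed_martingale_measures_def)
qed

lemma (in filtered_prob_space) q_optimal_iff:
  fixes S :: "real \<Rightarrow> 'a \<Rightarrow> real ^ 'd"
  assumes S: "cadlag_semimartingale M F S" and "q > 1"
    and u: "u \<in> signed_martingale_measures M F S \<inter> Lp_space M q"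
  shows "q_optimal M F S q u \<longleftrightarrow>
    (\<forall>v \<in> signed_martingale_measures M F S \<inter> Lp_space M q.
       signed_expectation M v (\<lambda>w. signed_powr (q - 1) (u w)) = (\<integral>w. \<bar>u w\<bar> powr q \<partial>M))"
    (is "_ \<longleftrightarrow> (\<forall>v \<in> ?A. ?E v = ?N)")
proof -
  have uL: "u \<in> Lp_space M q" using u by simp
  \<comment> \<open>Since \<open>signed_powr (q - 1) x * x = \<bar>x\<bar> powr q\<close>, testing
    against \<open>u\<close> itself gives \<open>?N\<close>; the derivative in direction
    \<open>v - u\<close> vanishes exactly when \<open>?E v = ?N\<close>.\<close>
  have diff: "(\<integral>w. signed_powr (q - 1) (u w) * (v w - u w) \<partial>M) = ?E v - ?N" if "v \<in> ?A" for v
    using integrable_signed_powr_mult[OF \<open>q > 1\<close> uL uL]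
      integrable_signed_powr_mult[OF \<open>q > 1\<close> uL, of v] that
    by (simp add: right_diff_distrib signed_expectation_def signed_powr_mult_self mult.commute[of "v _"])
  show ?thesis
  proof (intro iffI ballI)
    fix v assume opt: "q_optimal M F S q u" and v: "v \<in> ?A"
    have d: "(\<lambda>w. v w - u w) \<in> Lp_space M q"
      using u v \<open>q > 1\<close> by (intro Lp_space_diff) auto
    have "(\<lambda>w. u w + t * (v w - u w)) \<in> ?A" for t
      using u v d \<open>q > 1\<close> signed_martingale_measures_affine[OF S]
      by (auto intro!: Lp_space_add Lp_space_cmult)
    then have "?N \<le> (\<integral>w. \<bar>u w + t * (v w - u w)\<bar> powr q \<partial>M)" for t
      using opt \<open>q > 1\<close> by (auto simp: q_optimal_def Lp_norm_le_iff)
    then have "(\<integral>w. signed_powr (q - 1) (u w) * (v w - u w) \<partial>M) = 0"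
      using Lp_minimizer_first_order[OF \<open>q > 1\<close> uL d] by blast
    then show "?E v = ?N" using diff[OF v] by simp
  next
    assume eq: "\<forall>v \<in> ?A. ?E v = ?N"
    show "q_optimal M F S q u"
      unfolding q_optimal_def
    proof (intro conjI ballI impI)
      fix v assume v: "v \<in> ?A"
      then have ge: "(\<integral>w. signed_powr (q - 1) (u w) * (v w - u w) \<partial>M) \<ge> 0" and vL: "v \<in> Lp_space M q"
        using diff[OF v] eq by auto
      show "Lp_norm M q u \<le> Lp_norm M q v"
        using integral_abs_powr_tangent(1)[OF \<open>q > 1\<close> uL vL ge] \<open>q > 1\<close> by (simp add: Lp_norm_le_iff)
      assume "Lp_norm M q v = Lp_norm M q u"
      then have "(\<integral>w. \<bar>v w\<bar> powr q \<partial>M) \<le> ?N"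
        using \<open>q > 1\<close> Lp_norm_le_iff[of q M v u] by simp
      then show "AE w in M. v w = u w"
        by (rule integral_abs_powr_tangent(2)[OF \<open>q > 1\<close> uL vL ge])
    qed (rule u)
  qed
qed

text \<open>A factor \<open>c \<noteq> 0\<close> in front of \<open>g\<close> leaves the normalised
  density unchanged but multiplies the tested expectation by \<open>signed_powr (q - 1) c\<close>,
  so optimality alone cannot fix the value 1. Direction (i) therefore has two forms: for
  \<open>g\<close> normalised so that the integral of \<open>\<bar>g\<bar> powr q\<close> equals
  that of \<open>g\<close>, and for a suitable multiple of an arbitrary \<open>g\<close>.\<close>

theorem theorem2p5:
  fixes M :: "'a measure" and F :: "real \<Rightarrow> 'a measure"
    and S :: "real \<Rightarrow> 'a \<Rightarrow> real ^ 'd" and q :: real and g :: "'a \<Rightarrow> real"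
  assumes "filtered_prob_space M F"
    and "cadlag_semimartingale M F S"
    and "locally_bounded M F S"
    and "q > 1"
    and "g \<in> borel_measurable M"
    and "(\<lambda>w. g w / (\<integral>x. g x \<partial>M)) \<in> signed_martingale_measures M F S \<inter> Lp_space M q"
  shows "(q_optimal M F S q (\<lambda>w. g w / (\<integral>x. g x \<partial>M)) \<longrightarrow>
            ((\<integral>w. \<bar>g w\<bar> powr q \<partial>M) = (\<integral>w. g w \<partial>M) \<longrightarrow>
               (\<forall>u \<in> signed_martingale_measures M F S \<inter> Lp_space M q.
                  signed_expectation M u (\<lambda>w. sgn (g w) * \<bar>g w\<bar> powr (q - 1)) = 1)) \<and>
            (\<exists>c. c \<noteq> 0 \<and>
               (\<forall>u \<in> signed_martingale_measures M F S \<inter> Lp_space M q.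
                  signed_expectation M u (\<lambda>w. sgn (c * g w) * \<bar>c * g w\<bar> powr (q - 1)) = 1)))
       \<and> ((\<forall>u \<in> signed_martingale_measures M F S \<inter> Lp_space M q.
              signed_expectation M u (\<lambda>w. sgn (g w) * \<bar>g w\<bar> powr (q - 1)) = 1) \<longrightarrow>
            q_optimal M F S q (\<lambda>w. g w / (\<integral>x. g x \<partial>M)))"
proof -
  interpret filtered_prob_space M F by fact
  define G where "G = (\<integral>x. g x \<partial>M)"
  define u where "u = (\<lambda>w. g w / G)"
  define N where "N = (\<integral>w. \<bar>u w\<bar> powr q \<partial>M)"
  let ?A = "signed_martingale_measures M F S \<inter> Lp_space M q"
  have u: "u \<in> ?A" using assms(6) by (simp add: u_def G_def)
  then have u1: "(\<integral>w. u w \<partial>M) = 1" and uI: "integrable M (\<lambda>w. \<bar>u w\<bar> powr q)"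
    by (auto simp: signed_martingale_measures_def Lp_space_def)
  \<comment> \<open>Division by zero yields 0, so \<open>G = 0\<close> would make \<open>u\<close>
    vanish identically, against its integral 1.\<close>
  have "G \<noteq> 0" using u1 by (auto simp: u_def)
  have "N \<noteq> 0"
  proof
    assume "N = 0"
    then have "AE w in M. \<bar>u w\<bar> powr q = 0"
      using integral_nonneg_eq_0_iff_AE[OF uI] by (simp add: N_def)
    then have "(\<integral>w. u w \<partial>M) = 0" by (intro integral_eq_zero_AE) auto
    then show False using u1 by simp
  qed
  moreover have "N \<ge> 0" by (simp add: N_def)
  ultimately have "N > 0" by simp
  have N_g: "N = (\<integral>w. \<bar>g w\<bar> powr q \<partial>M) / \<bar>G\<bar> powr q"
    by (simp add: N_def u_def powr_divide)
  have scale: "signed_expectation M v (\<lambda>w. signed_powr (q - 1) (c * f w))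
      = signed_powr (q - 1) c * signed_expectation M v (\<lambda>w. signed_powr (q - 1) (f w))" for v c f
    by (simp add: signed_expectation_def signed_powr_mult mult.left_commute[of "v _"])
  have opt: "q_optimal M F S q u \<longleftrightarrow>
      (\<forall>v\<in>?A. signed_expectation M v (\<lambda>w. signed_powr (q - 1) (u w)) = N)"
    unfolding N_def by (rule q_optimal_iff[OF assms(2,4) u])
  \<comment> \<open>Write \<open>c * g\<close> as \<open>(c * G) * u\<close> and apply the criterion
    to \<open>u\<close>.\<close>
  have E_g: "signed_expectation M v (\<lambda>w. signed_powr (q - 1) (c * g w)) = signed_powr (q - 1) (c * G) * N"
    if "q_optimal M F S q u" "v \<in> ?A" for v c
    using scale[of v "c * G" u] opt that \<open>G \<noteq> 0\<close> by (simp add: u_def)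
  \<comment> \<open>Under the normalisation \<open>N = G / \<bar>G\<bar> powr q\<close>, which is
    the reciprocal of \<open>signed_powr (q - 1) G\<close>.\<close>
  have i1: "signed_expectation M v (\<lambda>w. signed_powr (q - 1) (g w)) = 1"
    if "q_optimal M F S q u" "v \<in> ?A" "(\<integral>w. \<bar>g w\<bar> powr q \<partial>M) = G" for v
    using E_g[OF that(1,2), of 1] that(3) \<open>G \<noteq> 0\<close> signed_powr_mult_self[of q G] by (simp add: N_g)
  \<comment> \<open>The solution of \<open>(c * G) powr (q - 1) * N = 1\<close> with
    \<open>c * G > 0\<close>.\<close>
  define c where "c = N powr (- 1 / (q - 1)) / G"
  have "c \<noteq> 0" using \<open>N > 0\<close> \<open>G \<noteq> 0\<close> by (simp add: c_def)
  have "signed_powr (q - 1) (c * G) = N powr (-1)"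
    using \<open>N > 0\<close> \<open>G \<noteq> 0\<close> \<open>q > 1\<close> by (simp add: c_def signed_powr_of_pos powr_powr)
  then have "signed_powr (q - 1) (c * G) * N = 1"
    using \<open>N > 0\<close> by (simp add: powr_minus_divide)
  then have i2: "\<exists>c. c \<noteq> 0 \<and> (\<forall>v\<in>?A. signed_expectation M v (\<lambda>w. signed_powr (q - 1) (c * g w)) = 1)"
    if "q_optimal M F S q u"
    using E_g[OF that] \<open>c \<noteq> 0\<close> by (intro exI[of _ c]) auto
  have ii: "q_optimal M F S q u"
    if E: "\<forall>v\<in>?A. signed_expectation M v (\<lambda>w. signed_powr (q - 1) (g w)) = 1"
  proof -
    have E': "signed_expectation M v (\<lambda>w. signed_powr (q - 1) (u w)) = signed_powr (q - 1) (1 / G)"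
      if "v \<in> ?A" for v
      using scale[of v "1 / G" g] E that by (simp add: u_def)
    \<comment> \<open>The expectation has the same value under all admissible densities; taking
      \<open>u\<close> itself identifies this value as \<open>N\<close>, as the criterion
      demands.\<close>
    have "signed_expectation M u (\<lambda>w. signed_powr (q - 1) (u w)) = N"
      by (simp add: signed_expectation_def N_def mult.commute[of "u _"] signed_powr_mult_self)
    then show ?thesis using opt E' E'[OF u] by simp
  qed
  show ?thesis
    using i1 i2 ii unfolding u_def G_def signed_powr_def by blast
qed

end
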